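(* Let $\mathfrak{g}$ be a finite-dimensional real nilpotent Lie algebra. If $\mathfrak{g}$ admits a generalized Kähler structure (with respect to some closed 3-form $H\in\wedge^3\mathfrak{g}^*$), then $\mathfrak{g}$ is abelian.
   Context: Let $\mathfrak{g}$ be a finite-dimensional real Lie algebra, with $\wedge^\bullet\mathfrak{g}^*$ equipped with the Chevalley–Eilenberg differential $d$, and let $H\in\wedge^3\mathfrak{g}^*$ be closed ($dH=0$). The Courant bracket on $\mathfrak{g}\oplus\mathfrak{g}^*$ is $$[\![X+\xi,Y+\eta]\!]= [X,Y] + \mathcal{L}_X \eta -\mathcal{L}_Y\xi + i_Y i_X H,$$ where $(\mathcal{L}_X\eta)(Z)=-\eta([X,Z])$; it is a Lie bracket. The natural pairing on $\mathfrak{g}\oplus\mathfrak{g}^*$ is $\langle X+\xi,Y+\eta\rangle=\tfrac12(\eta(X)+\xi(Y))$. Both are extended complex-bilinearly to $(\mathfrak{g}\oplus\mathfrak{g}^* )\otimes\mathbb{C}$. A generalized complex structure on $\mathfrak{g}$ with closed 3-form $H$ is a linear complex structure $\mathcal{J}$ on $\mathfrak{g}\oplus\mathfrak{g}^*$ ($\mathcal{J}^2=-1$), orthogonal with respect to the natural pairing, which is integrable, i.e. its $i$-eigenspace in $(\mathfrak{g}\oplus\mathfrak{g}^* )\otimes\mathbb{C}$ is closed under the Courant bracket. A generalized Kähler structure on $\mathfrak{g}$ with closed 3-form $H$ is a pair of commuting generalized complex structures $\mathcal{J}_1,\mathcal{J}_2$ on $\mathfrak{g}$ (with the same $H$) such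 that $\langle\mathcal{J}_1\mathcal{J}_2v,v\rangle>0$ for all nonzero $v\in\mathfrak{g}\oplus\mathfrak{g}^*$. *)

theory Defs
  imports "HOL-Analysis.Analysis"
begin

section \<open>The algebraic dual space\<close>

typedef (overloaded) 'a dual = "{f :: 'a::real_vector \<Rightarrow> real. linear f}"
  morphisms dual_app Dual
  by (auto intro: linear_zero)

setup_lifting type_definition_dual

lemma linear_dual_app: "linear (dual_app f)"
  using dual_app by auto

lemma dual_app_Dual: "linear f \<Longrightarrow> dual_app (Dual f) = f"
  by (simp add: Dual_inverse)

instantiation dual :: (real_vector) real_vector
begin

lift_definition zero_dual :: "'a dual" is "\<lambda>_. 0"
  by (rule linear_zero)

lift_definition plus_dual :: "'a dual \<Rightarrow> 'a dual \<Rightarrow> 'a dual" is "\<lambda>f g x. f x + g x"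
  by (rule linear_compose_add)

lift_definition uminus_dual :: "'a dual \<Rightarrow> 'a dual" is "\<lambda>f x. - f x"
  by (rule linear_compose_neg)

lift_definition minus_dual :: "'a dual \<Rightarrow> 'a dual \<Rightarrow> 'a dual" is "\<lambda>f g x. f x - g x"
  by (rule linear_compose_sub)

lift_definition scaleR_dual :: "real \<Rightarrow> 'a dual \<Rightarrow> 'a dual" is "\<lambda>c f x. c *\<^sub>R f x"
  by (rule linear_compose_scale_right)

instance
  by standard (transfer; simp add: fun_eq_iff algebra_simps)+

end

section \<open>Lie algebras\<close>

locale lie_algebra =
  fixes br :: "'a::real_vector \<Rightarrow> 'a \<Rightarrow> 'a"
  assumes bilinear_br: "bilinear br"
    and br_self: "br X X = 0"
    and jacobi: "br X (br Y Z) + br Y (br Z X) + br Z (br X Y) = 0"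

definition finite_dimensional :: "'a::real_vector itself \<Rightarrow> bool" where
  "finite_dimensional _ \<longleftrightarrow>
    (\<exists>B :: 'a set. finite_dimensional_vector_space ((*\<^sub>R) :: real \<Rightarrow> 'a \<Rightarrow> 'a) B)"

primrec lower_central :: "('a::real_vector \<Rightarrow> 'a \<Rightarrow> 'a) \<Rightarrow> nat \<Rightarrow> 'a set" where
  "lower_central br 0 = UNIV"
| "lower_central br (Suc k) = span {br X Y | X Y. Y \<in> lower_central br k}"

definition nilpotent_lie :: "('a::real_vector \<Rightarrow> 'a \<Rightarrow> 'a) \<Rightarrow> bool" where
  "nilpotent_lie br \<longleftrightarrow> (\<exists>k. lower_central br k = {0})"

definition abelian_lie :: "('a::real_vector \<Rightarrow> 'a \<Rightarrow> 'a) \<Rightarrow> bool" where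
  "abelian_lie br \<longleftrightarrow> (\<forall>X Y. br X Y = 0)"

section \<open>Closed 3-forms\<close>

definition three_form :: "('a::real_vector \<Rightarrow> 'a \<Rightarrow> 'a \<Rightarrow> real) \<Rightarrow> bool" where
  "three_form H \<longleftrightarrow>
    (\<forall>Y Z. linear (\<lambda>X. H X Y Z)) \<and> (\<forall>X Z. linear (\<lambda>Y. H X Y Z)) \<and> (\<forall>X Y. linear (\<lambda>Z. H X Y Z)) \<and>
    (\<forall>X Y. H X X Y = 0 \<and> H X Y Y = 0 \<and> H X Y X = 0)"

text \<open>The Chevalley--Eilenberg differential
  \<open>(d\<omega>)(X\<^sub>0,\<dots>,X\<^sub>k) = \<Sum>\<^sub>i\<^sub><\<^sub>j (-1)\<^sup>i\<^sup>+\<^sup>j \<omega>([X\<^sub>i,X\<^sub>j], X\<^sub>0,\<dots>,omit X\<^sub>i,\<dots>,omit X\<^sub>j,\<dots>,X\<^sub>k)\<close>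
  in degree 3.\<close>

definition ce_diff3 :: "('a::real_vector \<Rightarrow> 'a \<Rightarrow> 'a) \<Rightarrow> ('a \<Rightarrow> 'a \<Rightarrow> 'a \<Rightarrow> real)
    \<Rightarrow> 'a \<Rightarrow> 'a \<Rightarrow> 'a \<Rightarrow> 'a \<Rightarrow> real" where
  "ce_diff3 br H X0 X1 X2 X3 =
     - H (br X0 X1) X2 X3 + H (br X0 X2) X1 X3 - H (br X0 X3) X1 X2
     - H (br X1 X2) X0 X3 + H (br X1 X3) X0 X2 - H (br X2 X3) X0 X1"

definition closed_three_form ::
    "('a::real_vector \<Rightarrow> 'a \<Rightarrow> 'a) \<Rightarrow> ('a \<Rightarrow> 'a \<Rightarrow> 'a \<Rightarrow> real) \<Rightarrow> bool" where
  "closed_three_form br H \<longleftrightarrow>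
    three_form H \<and> (\<forall>X0 X1 X2 X3. ce_diff3 br H X0 X1 X2 X3 = 0)"

section \<open>The Courant bracket\<close>

type_synonym 'a gen = "'a \<times> 'a dual"

definition lie_deriv :: "('a::real_vector \<Rightarrow> 'a \<Rightarrow> 'a) \<Rightarrow> 'a \<Rightarrow> 'a dual \<Rightarrow> 'a dual" where
  "lie_deriv br X \<eta> = Dual (\<lambda>Z. - dual_app \<eta> (br X Z))"

text \<open>\<open>contract2 H X Y\<close> is \<open>i\<^sub>Y i\<^sub>X H\<close>.\<close>

definition contract2 :: "('a::real_vector \<Rightarrow> 'a \<Rightarrow> 'a \<Rightarrow> real) \<Rightarrow> 'a \<Rightarrow> 'a \<Rightarrow> 'a dual" where
  "contract2 H X Y = Dual (\<lambda>Z. H X Y Z)"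

text \<open>\<^term>\<open>Dual f\<close> is unspecified unless \<^term>\<open>f\<close> is linear; the next two lemmas
  show that the functionals above are linear for a Lie bracket and a 3-form.\<close>

lemma (in lie_algebra) dual_app_lie_deriv:
  "dual_app (lie_deriv br X \<eta>) Z = - dual_app \<eta> (br X Z)"
proof -
  have "linear (br X)"
    using bilinear_br by (simp add: bilinear_def)
  then have "linear (\<lambda>Z. dual_app \<eta> (br X Z))"
    by (rule linear_compose[OF _ linear_dual_app, unfolded o_def])
  then show ?thesis
    by (simp add: lie_deriv_def dual_app_Dual linear_compose_neg)
qed

lemma dual_app_contract2: "three_form H \<Longrightarrow> dual_app (contract2 H X Y) Z = H X Y Z"
  by (simp add: contract2_def three_form_def dual_app_Dual)

definition courant :: "('a::real_vector \<Rightarrow> 'a \<Rightarrow> 'a) \<Rightarrow> ('a \<Rightarrow> 'a \<Rightarrow> 'a \<Rightarrow> real)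
    \<Rightarrow> 'a gen \<Rightarrow> 'a gen \<Rightarrow> 'a gen" where
  "courant br H u v =
    (br (fst u) (fst v),
     lie_deriv br (fst u) (snd v) - lie_deriv br (fst v) (snd u) + contract2 H (fst u) (fst v))"

definition pairing :: "'a::real_vector gen \<Rightarrow> 'a gen \<Rightarrow> real" where
  "pairing u v = (dual_app (snd v) (fst u) + dual_app (snd u) (fst v)) / 2"

section \<open>Complexification\<close>

text \<open>The complexification of a real vector space \<open>V\<close> is \<open>V \<times> V\<close>, with \<open>(x, y)\<close>
  standing for \<open>x + \<i> y\<close>.\<close>

definition scale_cx :: "complex \<Rightarrow> 'v::real_vector \<times> 'v \<Rightarrow> 'v \<times> 'v" where
  "scale_cx c w = (Re c *\<^sub>R fst w - Im c *\<^sub>R snd w, Re c *\<^sub>R snd w + Im c *\<^sub>R fst w)"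

definition linear_cx :: "('v::real_vector \<Rightarrow> 'w::real_vector) \<Rightarrow> 'v \<times> 'v \<Rightarrow> 'w \<times> 'w" where
  "linear_cx f w = (f (fst w), f (snd w))"

definition bilinear_cx :: "('v::real_vector \<Rightarrow> 'v \<Rightarrow> 'w::real_vector) \<Rightarrow> 'v \<times> 'v \<Rightarrow> 'v \<times> 'v \<Rightarrow> 'w \<times> 'w" where
  "bilinear_cx b w z =
    (b (fst w) (fst z) - b (snd w) (snd z), b (fst w) (snd z) + b (snd w) (fst z))"

definition eigenspace_cx :: "('v::real_vector \<Rightarrow> 'v) \<Rightarrow> complex \<Rightarrow> ('v \<times> 'v) set" where
  "eigenspace_cx f c = {w. linear_cx f w = scale_cx c w}"

section \<open>Generalized complex and generalized Kaehler structures\<close>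

definition generalized_complex :: "('a::real_vector \<Rightarrow> 'a \<Rightarrow> 'a) \<Rightarrow> ('a \<Rightarrow> 'a \<Rightarrow> 'a \<Rightarrow> real)
    \<Rightarrow> ('a gen \<Rightarrow> 'a gen) \<Rightarrow> bool" where
  "generalized_complex br H J \<longleftrightarrow>
    linear J \<and> (\<forall>v. J (J v) = - v) \<and>
    (\<forall>u v. pairing (J u) (J v) = pairing u v) \<and>
    (\<forall>w \<in> eigenspace_cx J \<i>. \<forall>z \<in> eigenspace_cx J \<i>.
       bilinear_cx (courant br H) w z \<in> eigenspace_cx J \<i>)"

definition generalized_kaehler :: "('a::real_vector \<Rightarrow> 'a \<Rightarrow> 'a) \<Rightarrow> ('a \<Rightarrow> 'a \<Rightarrow> 'a \<Rightarrow> real)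
    \<Rightarrow> ('a gen \<Rightarrow> 'a gen) \<Rightarrow> ('a gen \<Rightarrow> 'a gen) \<Rightarrow> bool" where
  "generalized_kaehler br H J1 J2 \<longleftrightarrow>
    generalized_complex br H J1 \<and> generalized_complex br H J2 \<and>
    (\<forall>v. J1 (J2 v) = J2 (J1 v)) \<and>
    (\<forall>v. v \<noteq> 0 \<longrightarrow> pairing (J1 (J2 v)) v > 0)"

end

theory Submission
  imports Defs
begin

text \<open>Since \<open>dH = 0\<close>, the Courant bracket makes \<open>E = \<gg> \<oplus> \<gg>\<^sup>*\<close> a Lie algebra for which
  the natural pairing \<open>q\<close> is invariant, and \<open>E\<close> is nilpotent when \<open>\<gg>\<close> is.  The proof is a
  computation of traces in \<open>E\<close>, and it shows that even \<open>E\<close> is abelian; the bracket of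
  \<open>\<gg>\<close> is the first component of the bracket of \<open>E\<close>.

  Put \<open>G = J\<^sub>1 J\<^sub>2\<close>, so that \<open>q (G u) v\<close> is an inner product, let \<open>e\<^sub>i\<close> be an orthonormal
  basis for it, and let \<open>T(x,y,z) = q [x,y] z\<close>, an alternating form.  The contractions
  \<open>Q(\<alpha>,\<beta>,\<gamma>) = \<Sum>\<^sub>i\<^sub>j\<^sub>k T(e\<^sub>i,e\<^sub>j,e\<^sub>k) T(\<alpha> e\<^sub>i, \<beta> e\<^sub>j, \<gamma> e\<^sub>k)\<close> are symmetric in
  \<open>\<alpha>, \<beta>, \<gamma>\<close>, and \<open>Q(1,1,1)\<close> is the sum of the squares of all components of \<open>T\<close>.
  Integrability of \<open>J\<close> says that \<open>T\<close> vanishes on the \<open>\<i>\<close>-eigenspace of \<open>J\<close>; in real terms,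
  \<open>T(x,y,z) = T(Jx,Jy,z) + T(Jx,y,Jz) + T(x,Jy,Jz)\<close>.  Used with \<open>J\<^sub>2\<close>, and with \<open>J\<^sub>1\<close> after
  inserting \<open>G\<close> in two slots (note \<open>J\<^sub>1 G = - J\<^sub>2\<close>), this gives
  \<open>Q(1,1,1) = 3 Q(1,J\<^sub>2,J\<^sub>2)\<close> and \<open>Q(1,G,G) = - 2 Q(J\<^sub>1,J\<^sub>2,G) + Q(1,J\<^sub>2,J\<^sub>2)\<close>.

  Nilpotency makes both remaining terms vanish.  As \<open>G e\<^sub>i\<close> is the basis dual to
  \<open>e\<^sub>i\<close> under \<open>q\<close>, the number \<open>Q(1,G,G)\<close> is minus the sum of the traces of \<open>(ad e\<^sub>i)\<^sup>2\<close>
  (\<open>contr_id_G_G\<close>).  By the Jacobi identity \<open>2 Q(J\<^sub>1,J\<^sub>2,G)\<close> is the pairing of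
  \<open>\<Sum>\<^sub>i [e\<^sub>i, J\<^sub>1 e\<^sub>i]\<close> with \<open>\<Sum>\<^sub>j [e\<^sub>j, J\<^sub>2 e\<^sub>j]\<close> (\<open>contr_J1_J2_G\<close>), and the former vector is zero
  (\<open>sum_br_J1\<close>): its pairing with \<open>x\<close> is, up to a constant factor, the imaginary part of the
  trace of \<open>ad (x - \<i> J\<^sub>2 x)\<close> on the \<open>\<i>\<close>-eigenspace of \<open>J\<^sub>2\<close>, where this map is nilpotent.
  Hence \<open>T = 0\<close>.\<close>

section \<open>Traces of nilpotent maps in orthonormal bases\<close>

locale inner_form =
  fixes ip :: "'v::real_vector \<Rightarrow> 'v \<Rightarrow> real"
  assumes bilinear_ip: "bilinear ip"
    and ip_sym: "ip u v = ip v u"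
    and ip_pos: "v \<noteq> 0 \<Longrightarrow> ip v v > 0"
begin

definition orthonormal :: "'v set \<Rightarrow> bool" where
  "orthonormal B \<longleftrightarrow> finite B \<and> (\<forall>e\<in>B. \<forall>f\<in>B. ip e f = (if e = f then 1 else 0))"

definition trace_in :: "'v set \<Rightarrow> ('v \<Rightarrow> 'v) \<Rightarrow> real" where
  "trace_in B A = (\<Sum>e\<in>B. ip (A e) e)"

lemma linear_ip_left: "linear (\<lambda>u. ip u v)"
  and linear_ip_right: "linear (ip u)"
  using bilinear_ip by (simp_all add: bilinear_def)

lemma orthonormal_coefficient:
  assumes "orthonormal B" "f \<in> B"
  shows "ip (\<Sum>e\<in>B. c e *\<^sub>R e) f = c f"
proof -
  have "ip (\<Sum>e\<in>B. c e *\<^sub>R e) f = (\<Sum>e\<in>B. c e * ip e f)"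
    by (simp add: linear_sum[OF linear_ip_left] linear_scale[OF linear_ip_left])
  also have "\<dots> = (\<Sum>e\<in>B. if e = f then c e else 0)"
    using assms by (intro sum.cong) (auto simp: orthonormal_def)
  also have "\<dots> = c f"
    using assms by (simp add: orthonormal_def)
  finally show ?thesis .
qed

lemma orthonormal_expansion:
  assumes "orthonormal B" "v \<in> span B"
  shows "(\<Sum>e\<in>B. ip v e *\<^sub>R e) = v"
proof -
  have "finite B"
    using assms by (simp add: orthonormal_def)
  then obtain c where v: "v = (\<Sum>e\<in>B. c e *\<^sub>R e)"
    using assms(2) span_finite[of B] by auto
  show ?thesis
    by (subst (2) v, rule sum.cong[OF refl])
      (simp add: v orthonormal_coefficient[OF assms(1)])
qed

lemma orthonormal_parseval:
  assumes "orthonormal B" "u \<in> span B"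
  shows "(\<Sum>e\<in>B. ip u e * ip e v) = ip u v"
proof -
  have "ip u v = ip (\<Sum>e\<in>B. ip u e *\<^sub>R e) v"
    using orthonormal_expansion[OF assms] by simp
  then show ?thesis
    by (simp add: linear_sum[OF linear_ip_left] linear_scale[OF linear_ip_left])
qed

text \<open>One step of the Gram--Schmidt process: the normalised residual of the new vector
  is adjoined, unless it vanishes.\<close>

lemma orthonormal_insert:
  assumes B: "orthonormal B"
  shows "\<exists>B'. orthonormal B' \<and> B \<subseteq> B' \<and> span B' = span (insert x B)"
proof -
  define r where "r = x - (\<Sum>e\<in>B. ip x e *\<^sub>R e)"
  have p: "(\<Sum>e\<in>B. ip x e *\<^sub>R e) \<in> span B"
    by (intro span_sum span_scale span_base)
  show ?thesis
  proof (cases "r = 0")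
    case True
    then have "x \<in> span B"
      using p by (simp add: r_def)
    then have "span (insert x B) = span B"
      by (rule span_redundant)
    then show ?thesis
      using B by auto
  next
    case False
    define n where "n = (1 / sqrt (ip r r)) *\<^sub>R r"
    have pos: "ip r r > 0"
      using False by (rule ip_pos)
    have n1: "ip n n = 1"
      using pos by (simp add: n_def linear_scale[OF linear_ip_left] linear_scale[OF linear_ip_right]
        field_simps flip: power2_eq_square)
    have "ip r f = 0" if "f \<in> B" for f
      using orthonormal_coefficient[OF B that, of "ip x"]
      by (simp add: r_def linear_diff[OF linear_ip_left])
    then have n0: "ip n f = 0" if "f \<in> B" for f
      using that by (simp add: n_def linear_scale[OF linear_ip_left])
    have "orthonormal (insert n B)"
      using B n0 n1 n0[unfolded ip_sym[of n]] by (auto simp: orthonormal_def)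
    moreover have "span (insert n B) = span (insert x B)"
    proof -
      have sub: "span B \<subseteq> span (insert x B)" "span B \<subseteq> span (insert n B)"
        by (rule span_mono, blast)+
      have "r \<in> span (insert x B)"
        unfolding r_def by (rule span_diff[OF span_base subsetD[OF sub(1) p]]) simp
      then have n: "n \<in> span (insert x B)"
        unfolding n_def by (rule span_scale)
      have x_eq: "x = sqrt (ip r r) *\<^sub>R n + (\<Sum>e\<in>B. ip x e *\<^sub>R e)"
        using pos by (simp add: n_def r_def)
      have x: "x \<in> span (insert n B)"
        by (subst x_eq, rule span_add[OF span_scale[OF span_base] subsetD[OF sub(2) p]]) simp
      show ?thesis
        using n x sub span_superset[of B]
        by (intro equalityI span_minimal subspace_span) blast+
    qed
    ultimately show ?thesis
      by blast
  qed
qed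

lemma orthonormal_extend:
  assumes "finite S" "orthonormal B"
  shows "\<exists>B'. orthonormal B' \<and> B \<subseteq> B' \<and> span B' = span (S \<union> B)"
  using assms(1)
proof (induction S rule: finite_induct)
  case empty
  then show ?case
    using assms(2) by auto
next
  case (insert x S)
  then obtain C where C: "orthonormal C" "B \<subseteq> C" "span C = span (S \<union> B)"
    by blast
  obtain D where D: "orthonormal D" "C \<subseteq> D" "span D = span (insert x C)"
    using orthonormal_insert[OF C(1)] by blast
  have "span (insert x C) = span (insert x S \<union> B)"
    by (simp add: span_insert C(3))
  then show ?case
    using C D by (intro exI[of _ D]) auto
qed

lemma trace_in_independent:
  assumes B: "orthonormal B" "span B = UNIV" and C: "orthonormal C" "span C = UNIV"
    and A: "linear A"
  shows "trace_in B A = trace_in C A"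
proof -
  have "trace_in B A = (\<Sum>e\<in>B. \<Sum>f\<in>C. ip e f * ip f (A e))"
    unfolding trace_in_def
    by (rule sum.cong) (simp_all add: orthonormal_parseval[OF C(1)] C(2) ip_sym)
  also have "\<dots> = (\<Sum>f\<in>C. \<Sum>e\<in>B. ip f e * ip (A e) f)"
    by (subst sum.swap) (simp add: ip_sym)
  also have "\<dots> = (\<Sum>f\<in>C. ip (A (\<Sum>e\<in>B. ip f e *\<^sub>R e)) f)"
    by (simp add: linear_sum[OF A] linear_scale[OF A] linear_sum[OF linear_ip_left]
        linear_scale[OF linear_ip_left])
  also have "\<dots> = trace_in C A"
    unfolding trace_in_def
    by (rule sum.cong) (simp_all add: orthonormal_expansion[OF B(1)] B(2))
  finally show ?thesis .
qed

text \<open>An orthonormal basis adapted to the flag of the images of the powers of a nilpotent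
  map \<open>A\<close> has no diagonal terms: a basis vector \<open>e\<close> of the image of \<open>A ^^ j\<close> that is
  orthogonal to the image of \<open>A ^^ (j + 1)\<close> is in particular orthogonal to \<open>A e\<close>.\<close>

lemma trace_in_nilpotent:
  assumes B: "orthonormal B" "span B = UNIV"
    and A: "linear A" and nil: "\<And>v. (A ^^ m) v = 0"
  shows "trace_in B A = 0"
proof -
  have lin: "linear (A ^^ j)" for j
    by (induction j) (auto intro!: linear_compose A linear_id[unfolded id_def] simp: id_def simp del: o_apply)
  have "\<exists>C. orthonormal C \<and> span C = range (A ^^ (m - j)) \<and> (\<forall>e\<in>C. ip (A e) e = 0)"
    if "j \<le> m" for j
    using that
  proof (induction j)
    case 0
    have "range (A ^^ m) = {0}"
      using nil by auto
    then show ?case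
      by (intro exI[of _ "{}"]) (simp add: orthonormal_def)
  next
    case (Suc j)
    define i where "i = m - Suc j"
    have i: "m - j = Suc i"
      using Suc.prems by (simp add: i_def)
    obtain C where C: "orthonormal C" "span C = range (A ^^ Suc i)" "\<forall>e\<in>C. ip (A e) e = 0"
      using Suc i by auto
    obtain D where D: "orthonormal D" "C \<subseteq> D" "span D = span ((A ^^ i) ` B \<union> C)"
      using orthonormal_extend[OF _ C(1), of "(A ^^ i) ` B"] B(1)
      by (auto simp: orthonormal_def)
    have img: "span ((A ^^ i) ` B) = range (A ^^ i)"
      using linear_span_image[OF lin, of i B] B(2) by simp
    have "C \<subseteq> span ((A ^^ i) ` B)"
    proof
      fix e assume "e \<in> C"
      then have "e \<in> range (A ^^ Suc i)"
        using C(2) span_base by blast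
      then show "e \<in> span ((A ^^ i) ` B)"
        unfolding img by (auto simp: funpow_swap1)
    qed
    then have D_img: "span D = range (A ^^ i)"
      using D(3) img
      by (metis Un_least span_superset span_minimal subspace_span span_mono Un_upper1 subset_antisym)
    have "ip (A e) e = 0" if e: "e \<in> D" for e
    proof (cases "e \<in> C")
      case True
      then show ?thesis
        using C(3) by simp
    next
      case False
      have "e \<in> range (A ^^ i)"
        using D_img e span_base by blast
      then have "A e \<in> span C"
        unfolding C(2) by auto
      then have "ip (A e) e = (\<Sum>f\<in>C. ip (A e) f * ip f e)"
        by (simp add: orthonormal_parseval[OF C(1)])
      also have "\<dots> = 0"
        using False D(1,2) e by (intro sum.neutral ballI) (metis orthonormal_def subsetD mult_zero_right)
      finally show ?thesis .
    qed
    then show ?case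
      using D(1) D_img i_def by auto
  qed
  from this[of m] obtain C where C: "orthonormal C" "span C = range (A ^^ 0)" "\<forall>e\<in>C. ip (A e) e = 0"
    by auto
  have "trace_in B A = trace_in C A"
    using C by (intro trace_in_independent B A) auto
  also have "\<dots> = 0"
    using C(3) by (simp add: trace_in_def)
  finally show ?thesis .
qed

text \<open>The element \<open>\<Sum> J e \<otimes> e\<close> is antisymmetric because the matrix of \<open>J\<close> is.\<close>

lemma sum_skew_swap:
  assumes B: "orthonormal B" "span B = UNIV"
    and f: "bilinear f" and skew: "\<And>u v. ip (J u) v = - ip u (J v)"
  shows "(\<Sum>e\<in>B. f (J e) e) = - (\<Sum>e\<in>B. (f e (J e) :: real))"
proof -
  have lin: "linear (\<lambda>u. f u v)" "linear (f u)" for u v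
    using f by (simp_all add: bilinear_def)
  have J: "ip (J e) g = - ip (J g) e" for e g
    by (subst skew) (simp add: ip_sym)
  have "(\<Sum>e\<in>B. f (J e) e) = (\<Sum>e\<in>B. f (\<Sum>g\<in>B. ip (J e) g *\<^sub>R g) e)"
    by (simp add: orthonormal_expansion[OF B(1)] B(2))
  also have "\<dots> = (\<Sum>e\<in>B. \<Sum>g\<in>B. ip (J e) g * f g e)"
    by (simp add: linear_sum[OF lin(1)] linear_scale[OF lin(1)])
  also have "\<dots> = (\<Sum>g\<in>B. \<Sum>e\<in>B. - (ip (J g) e * f g e))"
    by (subst sum.swap) (intro sum.cong refl, metis J mult_minus_left)
  also have "\<dots> = - (\<Sum>g\<in>B. f g (\<Sum>e\<in>B. ip (J g) e *\<^sub>R e))"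
    by (simp add: linear_sum[OF lin(2)] linear_scale[OF lin(2)] sum_negf)
  also have "\<dots> = - (\<Sum>e\<in>B. f e (J e))"
    by (simp add: orthonormal_expansion[OF B(1)] B(2))
  finally show ?thesis .
qed

end

section \<open>Nilpotent Lie algebras\<close>

context lie_algebra
begin

lemma linear_br_left: "linear (\<lambda>x. br x y)"
  and linear_br_right: "linear (br x)"
  using bilinear_br by (simp_all add: bilinear_def)

lemma br_skew: "br x y = - br y x"
proof -
  have "br (x + y) (x + y) = br x y + br y x"
    unfolding linear_add[OF linear_br_left] linear_add[OF linear_br_right] by (simp add: br_self)
  then show ?thesis
    unfolding eq_neg_iff_add_eq_0 by (metis br_self)
qed

lemma br_br: "br (br x y) z = br x (br y z) - br y (br x z)"
proof -
  have "br y (br z x) = - br y (br x z)"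
    by (subst br_skew[of z x]) (rule linear_neg[OF linear_br_right])
  moreover have "br z (br x y) = - br (br x y) z"
    by (rule br_skew)
  ultimately show ?thesis
    using jacobi[of x y z] by (simp add: algebra_simps)
qed

lemma subspace_lower_central: "subspace (lower_central br k)"
  by (cases k) auto

lemma br_lower_central: "y \<in> lower_central br k \<Longrightarrow> br x y \<in> lower_central br (Suc k)"
  by (auto intro: span_base)

lemma lower_central_Suc_subset: "lower_central br (Suc k) \<subseteq> lower_central br k"
proof (induction k)
  case (Suc k)
  show ?case
    unfolding lower_central.simps(2)[of br "Suc k"] lower_central.simps(2)[of br k]
    by (rule span_mono) (use Suc in auto)
qed simp

lemma funpow_ad_lower_central: "((br x) ^^ n) v \<in> lower_central br n"
  by (induction n) (simp, metis br_lower_central funpow.simps(2) o_apply)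

lemma funpow_ad_ad_lower_central: "((\<lambda>v. br x (br y v)) ^^ n) v \<in> lower_central br n"
proof (induction n)
  case (Suc n)
  then have "br y (((\<lambda>v. br x (br y v)) ^^ n) v) \<in> lower_central br n"
    using br_lower_central lower_central_Suc_subset by blast
  then show ?case
    using br_lower_central by simp
qed simp

text \<open>For an integrable complex structure \<open>J\<close> the vectors \<open>x - \<i> J x\<close> form a complex
  subalgebra, and \<open>M x\<close> is \<open>\<i>\<close> times the restriction of \<open>ad (x - \<i> J x)\<close> to it, read
  off on real parts.  Since \<open>J\<close> need not preserve the lower central series, the
  real part \<open>p\<close> and, up to sign, the imaginary part \<open>J p\<close> have to be controlled together.\<close>

lemma funpow_holomorphic_ad_lower_central:
  assumes J: "\<And>v. J (J v) = - v"
    and int: "\<And>x y. J (br x y - br (J x) (J y)) = br (J x) y + br x (J y)"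
    and linJ: "linear J"
  defines "M \<equiv> (\<lambda>x y. br (J x) y + br x (J y))"
  shows "(M x ^^ n) v \<in> lower_central br n \<and> J ((M x ^^ n) v) \<in> lower_central br n"
proof (induction n)
  case (Suc n)
  let ?p = "(M x ^^ n) v"
  have "J (M x ?p) = - (br x ?p - br (J x) (J ?p))"
    unfolding M_def int[symmetric] by (rule J)
  then have "J (M x ?p) = br (J x) (J ?p) - br x ?p"
    by simp
  moreover have "br (J x) (J ?p) - br x ?p \<in> lower_central br (Suc n)"
    by (rule subspace_diff[OF subspace_lower_central]; rule br_lower_central; use Suc in blast)
  moreover have "M x ?p \<in> lower_central br (Suc n)"
    unfolding M_def
    by (rule subspace_add[OF subspace_lower_central]; rule br_lower_central;
        use Suc in \<open>simp add: M_def\<close>)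
  ultimately show ?case
    by simp
qed simp

end

section \<open>Kaehler pairs on nilpotent metric Lie algebras\<close>

text \<open>The hypotheses keep only what the trace computation sees of \<open>\<gg> \<oplus> \<gg>\<^sup>*\<close>; integrability
  is the vanishing of the Nijenhuis tensor, with \<open>J\<close> moved to the other side.\<close>

locale nilpotent_kaehler_pair = lie_algebra br
  for br :: "'v::real_vector \<Rightarrow> 'v \<Rightarrow> 'v" +
  fixes q :: "'v \<Rightarrow> 'v \<Rightarrow> real" and J1 J2 :: "'v \<Rightarrow> 'v"
  assumes finite_dim: "\<exists>S :: 'v set. finite S \<and> span S = UNIV"
    and nilpotent: "nilpotent_lie br"
    and bilinear_q: "bilinear q"
    and q_sym: "q u v = q v u"
    and q_invariant: "q (br x y) z = q x (br y z)"
    and linear_J1: "linear J1" and linear_J2: "linear J2"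
    and J1_J1: "J1 (J1 v) = - v" and J2_J2: "J2 (J2 v) = - v"
    and J_commute: "J1 (J2 v) = J2 (J1 v)"
    and q_J1: "q (J1 u) (J1 v) = q u v" and q_J2: "q (J2 u) (J2 v) = q u v"
    and integrable_J1: "J1 (br x y - br (J1 x) (J1 y)) = br (J1 x) y + br x (J1 y)"
    and integrable_J2: "J2 (br x y - br (J2 x) (J2 y)) = br (J2 x) y + br x (J2 y)"
    and positive: "v \<noteq> 0 \<Longrightarrow> q (J1 (J2 v)) v > 0"
begin

definition G :: "'v \<Rightarrow> 'v" where
  "G v = J1 (J2 v)"

definition T :: "'v \<Rightarrow> 'v \<Rightarrow> 'v \<Rightarrow> real" where
  "T x y z = q (br x y) z"

lemma linear_q_left: "linear (\<lambda>u. q u v)"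
  and linear_q_right: "linear (q u)"
  using bilinear_q by (simp_all add: bilinear_def)

lemmas q_simps = linear_add[OF linear_q_left] linear_add[OF linear_q_right]
  linear_diff[OF linear_q_left] linear_diff[OF linear_q_right]
  linear_neg[OF linear_q_left] linear_neg[OF linear_q_right]
  linear_scale[OF linear_q_left] linear_scale[OF linear_q_right]
  linear_sum[OF linear_q_left] linear_sum[OF linear_q_right]

lemmas br_simps = linear_neg[OF linear_br_left] linear_neg[OF linear_br_right]

lemma q_J1_skew: "q (J1 u) v = - q u (J1 v)"
  using q_J1[of "J1 u" v] by (simp add: J1_J1 q_simps)

lemma q_J2_skew: "q (J2 u) v = - q u (J2 v)"
  using q_J2[of "J2 u" v] by (simp add: J2_J2 q_simps)

lemma q_G: "q (G u) v = q u (G v)"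
  by (simp add: G_def q_J1_skew q_J2_skew J_commute)

lemma linear_G: "linear G"
  using linear_compose[OF linear_J2 linear_J1] by (simp add: G_def[abs_def] o_def)

lemma J1_G: "J1 (G v) = - J2 v"
  by (simp add: G_def J1_J1)

lemma G_J2: "G (J2 v) = - J1 v"
  by (simp add: G_def J2_J2 linear_neg[OF linear_J1])

sublocale inner_form "\<lambda>u v. q (G u) v"
proof
  show "bilinear (\<lambda>u v. q (G u) v)"
    using linear_compose[OF linear_G linear_q_left] linear_q_right
    by (simp add: bilinear_def o_def)
  show "q (G u) v = q (G v) u" for u v
    by (simp add: q_G q_sym[of u])
  show "q (G v) v > 0" if "v \<noteq> 0" for v
    using positive[OF that] by (simp add: G_def)
qed

lemma T_skew: "T x y z = - T y x z"
  unfolding T_def by (subst br_skew) (simp add: q_simps)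

lemma T_cyclic: "T x y z = T y z x"
  by (simp add: T_def q_invariant q_sym[of x])

lemma T_integrable:
  assumes q_J: "\<And>u v. q (J u) (J v) = q u v"
    and int: "\<And>x y. J (br x y - br (J x) (J y)) = br (J x) y + br x (J y)"
  shows "T x y z = T (J x) (J y) z + T (J x) y (J z) + T x (J y) (J z)"
proof -
  have "T x y z - T (J x) (J y) z = q (J (br x y - br (J x) (J y))) (J z)"
    by (simp add: T_def q_J q_simps)
  then show ?thesis
    unfolding int by (simp add: T_def q_simps)
qed

text \<open>The pairing of two brackets obeys the first Bianchi identity of a curvature tensor:
  this is the Jacobi identity, moved into \<open>q\<close> by invariance.\<close>

lemma q_br_br: "q (br x y) (br z w) = q (br x z) (br y w) - q (br y z) (br x w)"
proof -
  have "q (br x y) (br z w) = q (br (br x y) z) w"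
    by (simp add: q_invariant)
  also have "\<dots> = q (br x (br y z)) w - q (br y (br x z)) w"
    by (simp add: br_br q_simps)
  also have "\<dots> = - q (br (br y z) x) w + q (br (br x z) y) w"
    by (simp add: br_skew[of x "br y z"] br_skew[of y "br x z"] q_simps)
  also have "\<dots> = q (br x z) (br y w) - q (br y z) (br x w)"
    by (simp add: q_invariant)
  finally show ?thesis .
qed

definition contr :: "'v set \<Rightarrow> ('v \<Rightarrow> 'v) \<Rightarrow> ('v \<Rightarrow> 'v) \<Rightarrow> ('v \<Rightarrow> 'v) \<Rightarrow> real" where
  "contr B \<alpha> \<beta> \<gamma> = (\<Sum>e\<in>B. \<Sum>f\<in>B. \<Sum>g\<in>B. T e f g * T (\<alpha> e) (\<beta> f) (\<gamma> g))"

lemma contr_swap: "contr B \<alpha> \<beta> \<gamma> = contr B \<beta> \<alpha> \<gamma>"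
proof -
  have "contr B \<alpha> \<beta> \<gamma> = (\<Sum>f\<in>B. \<Sum>e\<in>B. \<Sum>g\<in>B. T e f g * T (\<alpha> e) (\<beta> f) (\<gamma> g))"
    unfolding contr_def by (rule sum.swap)
  also have "\<dots> = contr B \<beta> \<alpha> \<gamma>"
    unfolding contr_def
    by (intro sum.cong refl) (metis T_skew minus_mult_minus)
  finally show ?thesis .
qed

lemma contr_rotate: "contr B \<alpha> \<beta> \<gamma> = contr B \<beta> \<gamma> \<alpha>"
proof -
  have "contr B \<alpha> \<beta> \<gamma> = (\<Sum>f\<in>B. \<Sum>e\<in>B. \<Sum>g\<in>B. T e f g * T (\<alpha> e) (\<beta> f) (\<gamma> g))"
    unfolding contr_def by (rule sum.swap)
  also have "\<dots> = (\<Sum>f\<in>B. \<Sum>g\<in>B. \<Sum>e\<in>B. T e f g * T (\<alpha> e) (\<beta> f) (\<gamma> g))"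
    by (intro sum.cong refl sum.swap)
  also have "\<dots> = contr B \<beta> \<gamma> \<alpha>"
    unfolding contr_def
    by (intro sum.cong refl) (metis T_cyclic)
  finally show ?thesis .
qed

context
  fixes B :: "'v set"
  assumes B: "orthonormal B" "span B = UNIV"
begin

lemma orthonormal_sum: "(\<Sum>e\<in>B. q (G v) e *\<^sub>R e) = v"
  using orthonormal_expansion[OF B(1)] B(2) by simp

text \<open>The vectors \<open>G e\<close> form the basis dual to \<open>B\<close> under \<open>q\<close>.\<close>

lemma sum_q_G: "(\<Sum>e\<in>B. q u e * q v (G e)) = q u v"
proof -
  have "q u v = q u (\<Sum>e\<in>B. q (G v) e *\<^sub>R e)"
    by (simp only: orthonormal_sum)
  then show ?thesis
    by (simp add: q_simps q_G mult.commute)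
qed

lemma contr_G: "contr B \<alpha> \<beta> G = (\<Sum>e\<in>B. \<Sum>f\<in>B. q (br e f) (br (\<alpha> e) (\<beta> f)))"
  by (simp add: contr_def T_def sum_q_G)

lemma contr_integrable:
  assumes "\<And>u v. q (J u) (J v) = q u v"
    and "\<And>x y. J (br x y - br (J x) (J y)) = br (J x) y + br x (J y)"
  shows "contr B \<alpha> \<beta> \<gamma> = contr B (\<lambda>v. J (\<alpha> v)) (\<lambda>v. J (\<beta> v)) \<gamma>
    + contr B (\<lambda>v. J (\<alpha> v)) \<beta> (\<lambda>v. J (\<gamma> v)) + contr B \<alpha> (\<lambda>v. J (\<beta> v)) (\<lambda>v. J (\<gamma> v))"
  unfolding contr_def sum.distrib[symmetric] distrib_left[symmetric]
    T_integrable[of J, OF assms, symmetric] ..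

lemma lower_central_zero:
  obtains m where "\<And>v. v \<in> lower_central br m \<Longrightarrow> v = 0"
  using nilpotent unfolding nilpotent_lie_def by auto

lemma trace_ad: "trace_in B (br x) = 0"
proof -
  obtain m where "\<And>v. v \<in> lower_central br m \<Longrightarrow> v = 0"
    by (rule lower_central_zero) blast
  then show ?thesis
    using funpow_ad_lower_central by (intro trace_in_nilpotent[OF B linear_br_right]) blast
qed

lemma trace_ad_ad: "trace_in B (\<lambda>v. br x (br y v)) = 0"
proof -
  obtain m where "\<And>v. v \<in> lower_central br m \<Longrightarrow> v = 0"
    by (rule lower_central_zero) blast
  moreover have "linear (\<lambda>v. br x (br y v))"
    using linear_compose[OF linear_br_right linear_br_right] by (simp add: o_def)
  ultimately show ?thesis
    using funpow_ad_ad_lower_central by (intro trace_in_nilpotent[OF B]) blast+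
qed

text \<open>Both \<open>ad (J2 x)\<close> and its sum with \<open>ad x \<circ> J2\<close>, the holomorphic adjoint map above,
  are nilpotent, so the difference has trace zero although it need not be nilpotent.\<close>

lemma trace_ad_J2: "trace_in B (\<lambda>v. br x (J2 v)) = 0"
proof -
  obtain m where m: "\<And>v. v \<in> lower_central br m \<Longrightarrow> v = 0"
    by (rule lower_central_zero) blast
  have "linear (\<lambda>v. br (J2 x) v + br x (J2 v))"
    using linear_compose_add[OF linear_br_right linear_compose[OF linear_J2 linear_br_right]]
    by (simp add: o_def)
  then have "trace_in B (\<lambda>v. br (J2 x) v + br x (J2 v)) = 0"
    using m funpow_holomorphic_ad_lower_central[OF J2_J2 integrable_J2 linear_J2]
    by (intro trace_in_nilpotent[OF B]) blast+
  moreover have "trace_in B (\<lambda>v. br (J2 x) v + br x (J2 v))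
      = trace_in B (br (J2 x)) + trace_in B (\<lambda>v. br x (J2 v))"
    by (simp add: trace_in_def q_simps linear_add[OF linear_G] sum.distrib)
  ultimately show ?thesis
    by (simp add: trace_ad)
qed

lemma J1_skew: "q (G (J1 u)) v = - q (G u) (J1 v)"
  by (simp add: G_def q_J1_skew q_J2_skew J_commute q_simps)

lemma J2_skew: "q (G (J2 u)) v = - q (G u) (J2 v)"
  by (simp add: G_def q_J1_skew q_J2_skew J_commute q_simps)

text \<open>The vector \<open>\<Sum> [e, J1 e]\<close> pairs with \<open>x\<close> to the trace of \<open>ad x \<circ> J2\<close>: the operator
  \<open>J1 = - G J2\<close> supplies the factor \<open>G\<close> that turns \<open>q\<close> into the inner product.\<close>

lemma sum_br_J1: "(\<Sum>e\<in>B. q (br e (J1 e)) x) = 0"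
proof -
  have bil: "bilinear (\<lambda>u v. q (G (br x u)) v)"
    using linear_q_right linear_compose[OF linear_br_right linear_compose[OF linear_G linear_q_left]]
    by (simp add: bilinear_def o_def)
  have "q (br e (J1 e)) x = - q (G (br x e)) (J2 e)" for e
  proof -
    have "q (br e (J1 e)) x = T x e (J1 e)"
      using T_cyclic by (simp add: T_def[symmetric])
    also have "\<dots> = - q (br x e) (G (J2 e))"
      by (simp add: T_def G_J2 q_simps)
    finally show ?thesis
      by (simp add: q_G)
  qed
  then have "(\<Sum>e\<in>B. q (br e (J1 e)) x) = - (\<Sum>e\<in>B. q (G (br x e)) (J2 e))"
    by (simp add: sum_negf)
  also have "\<dots> = (\<Sum>e\<in>B. q (G (br x (J2 e))) e)"
    using sum_skew_swap[OF B bil, of J2, OF J2_skew] by simp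
  also have "\<dots> = 0"
    using trace_ad_J2 by (simp add: trace_in_def)
  finally show ?thesis .
qed

text \<open>In the sum over \<open>e\<close> the two terms of the Bianchi identity agree, by antisymmetry
  of \<open>\<Sum> J1 e \<otimes> e\<close>.\<close>

lemma contr_J1_J2_G: "contr B J1 J2 G = 0"
proof -
  have bil: "bilinear (\<lambda>u v. q (br u f) (br v (J2 f)))" for f
    using linear_compose[OF linear_br_left linear_q_right] linear_compose[OF linear_br_left linear_q_left]
    by (simp add: bilinear_def o_def)
  have "0 = (\<Sum>f\<in>B. \<Sum>e\<in>B. q (br e (J1 e)) (br f (J2 f)))"
    by (simp add: sum_br_J1)
  also have "\<dots> = (\<Sum>f\<in>B. (\<Sum>e\<in>B. q (br e f) (br (J1 e) (J2 f)))
      - (\<Sum>e\<in>B. q (br (J1 e) f) (br e (J2 f))))"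
    unfolding sum_subtractf[symmetric] by (intro sum.cong refl q_br_br)
  also have "\<dots> = (\<Sum>f\<in>B. 2 * (\<Sum>e\<in>B. q (br e f) (br (J1 e) (J2 f))))"
    by (intro sum.cong refl) (simp add: sum_skew_swap[OF B bil J1_skew])
  also have "\<dots> = 2 * contr B J1 J2 G"
    unfolding contr_G sum_distrib_left by (rule sum.swap)
  finally show ?thesis
    by simp
qed

text \<open>This is the vanishing of the Killing form on each pair \<open>(e, e)\<close>.\<close>

lemma contr_id_G_G: "contr B (\<lambda>v. v) G G = 0"
proof -
  have "q (br e f) (br e (G f)) = - q (G (br e (br e f))) f" for e f
  proof -
    have "q (br e f) (br e (G f)) = q (br e (G f)) (br e f)"
      by (rule q_sym)
    also have "\<dots> = - q (br (G f) e) (br e f)"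
      by (subst br_skew) (simp add: q_simps)
    also have "\<dots> = - q (G (br e (br e f))) f"
      by (simp add: q_invariant q_sym[of "G f"] q_G[symmetric])
    finally show ?thesis .
  qed
  then have "contr B (\<lambda>v. v) G G = - (\<Sum>e\<in>B. trace_in B (\<lambda>f. br e (br e f)))"
    by (simp add: contr_G trace_in_def sum_negf)
  then show ?thesis
    by (simp add: trace_ad_ad)
qed

lemma contr_id_J2_J2: "contr B (\<lambda>v. v) J2 J2 = 0"
proof -
  have neg: "contr B \<alpha> (\<lambda>v. - \<beta> v) \<gamma> = - contr B \<alpha> \<beta> \<gamma>"
    "contr B \<alpha> \<beta> (\<lambda>v. - \<gamma> v) = - contr B \<alpha> \<beta> \<gamma>" for \<alpha> \<beta> \<gamma>
    by (simp_all add: contr_def T_def q_simps br_simps sum_negf)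
  have "contr B J1 G J2 = contr B J1 J2 G"
    by (metis contr_rotate contr_swap)
  then show ?thesis
    using contr_integrable[of J1 "\<lambda>v. v" G G, OF q_J1 integrable_J1]
    by (simp add: J1_G neg contr_id_G_G contr_J1_J2_G)
qed

lemma contr_id: "contr B (\<lambda>v. v) (\<lambda>v. v) (\<lambda>v. v) = 0"
proof -
  have "contr B J2 J2 (\<lambda>v. v) = 0" "contr B J2 (\<lambda>v. v) J2 = 0"
    using contr_id_J2_J2 by (metis contr_rotate)+
  then show ?thesis
    using contr_integrable[of J2 "\<lambda>v. v" "\<lambda>v. v" "\<lambda>v. v", OF q_J2 integrable_J2] by (simp add: contr_id_J2_J2)
qed

lemma br_basis_eq_0:
  assumes "e \<in> B" "f \<in> B"
  shows "br e f = 0"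
proof -
  have fin: "finite B"
    using B(1) by (simp add: orthonormal_def)
  have "T e f g = 0" if "g \<in> B" for g
    using contr_id assms that
    by (simp add: contr_def sum_nonneg_eq_0_iff fin sum_nonneg)
  then have "q (br e f) x = 0" for x
    using sum_q_G[of "br e f" x] by (simp add: T_def)
  then show ?thesis
    using ip_pos[of "br e f"] q_G[of "br e f" "br e f"] by force
qed

lemma br_eq_0: "br x y = 0"
proof -
  have "br x y = br (\<Sum>e\<in>B. q (G x) e *\<^sub>R e) (\<Sum>f\<in>B. q (G y) f *\<^sub>R f)"
    by (simp only: orthonormal_sum)
  also have "\<dots> = 0"
    by (simp add: linear_sum[OF linear_br_left] linear_sum[OF linear_br_right]
        linear_scale[OF linear_br_left] linear_scale[OF linear_br_right] br_basis_eq_0)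
  finally show ?thesis .
qed

end

theorem abelian: "abelian_lie br"
proof -
  obtain S :: "'v set" where "finite S" "span S = UNIV"
    using finite_dim by blast
  then obtain B where "orthonormal B" "span B = UNIV"
    using orthonormal_extend[of S "{}"] by (auto simp: orthonormal_def)
  then show ?thesis
    using br_eq_0 by (simp add: abelian_lie_def)
qed

end

section \<open>The Courant bracket as a nilpotent metric Lie algebra\<close>

lemmas dual_app_simps = zero_dual.rep_eq plus_dual.rep_eq uminus_dual.rep_eq
  minus_dual.rep_eq scaleR_dual.rep_eq

lemmas dual_app_linear = linear_add[OF linear_dual_app] linear_diff[OF linear_dual_app]
  linear_neg[OF linear_dual_app] linear_scale[OF linear_dual_app] linear_0[OF linear_dual_app]

lemma dual_eqI: "(\<And>x. dual_app f x = dual_app g x) \<Longrightarrow> f = g"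
  by (simp add: dual_app_inject[symmetric] fun_eq_iff)

lemma bilinear_pairing: "bilinear pairing"
  unfolding bilinear_def
  by (auto intro!: linearI simp: pairing_def dual_app_simps dual_app_linear field_simps)

lemma pairing_sym: "pairing u v = pairing v u"
  by (simp add: pairing_def add.commute)

text \<open>A basis and its coordinate functionals span \<open>\<gg> \<oplus> \<gg>\<^sup>*\<close>.\<close>

lemma finite_dimensional_gen:
  assumes "finite_dimensional TYPE('a::real_vector)"
  shows "\<exists>S :: 'a gen set. finite S \<and> span S = UNIV"
proof -
  obtain B :: "'a set"
    where "finite_dimensional_vector_space ((*\<^sub>R) :: real \<Rightarrow> 'a \<Rightarrow> 'a) B"
    using assms by (auto simp: finite_dimensional_def)
  then have fin: "finite B" and ind: "independent B" and spn: "span B = UNIV"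
    by (auto simp: finite_dimensional_vector_space_def finite_dimensional_vector_space_axioms_def
        dependent_raw_def span_raw_def)
  define c where "c = (\<lambda>b. Dual (\<lambda>v. representation B v b))"
  have c: "dual_app (c b) v = representation B v b" for b v
    unfolding c_def
    by (subst dual_app_Dual)
      (auto intro!: linearI simp: representation_add[OF ind] representation_scale[OF ind] spn)
  let ?S = "(\<lambda>b. (b, 0)) ` B \<union> (\<lambda>b. (0, c b)) ` B"
  have "w \<in> span ?S" for w :: "'a gen"
  proof -
    have lin: "linear (\<lambda>v :: 'a. (v, 0 :: 'a dual))" "linear (\<lambda>f :: 'a dual. (0 :: 'a, f))"
      by (auto intro!: linearI)
    have v: "v = (\<Sum>b\<in>B. representation B v b *\<^sub>R b)" for v
      using sum_representation_eq[OF ind _ fin, of v] spn by simp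
    have "f = (\<Sum>b\<in>B. dual_app f b *\<^sub>R c b)" for f
    proof (rule dual_eqI)
      fix x
      have lin_x: "linear (\<lambda>g :: 'a dual. dual_app g x)"
        by (auto intro!: linearI simp: dual_app_simps)
      have "dual_app (\<Sum>b\<in>B. dual_app f b *\<^sub>R c b) x = (\<Sum>b\<in>B. dual_app f b * representation B x b)"
        by (simp add: linear_sum[OF lin_x] linear_scale[OF lin_x] c)
      also have "\<dots> = dual_app f (\<Sum>b\<in>B. representation B x b *\<^sub>R b)"
        by (simp add: linear_sum[OF linear_dual_app] linear_scale[OF linear_dual_app] mult.commute)
      finally show "dual_app f x = dual_app (\<Sum>b\<in>B. dual_app f b *\<^sub>R c b) x"
        by (simp add: v[symmetric])
    qed
    then have "w = (\<Sum>b\<in>B. representation B (fst w) b *\<^sub>R (b, 0)) + (\<Sum>b\<in>B. dual_app (snd w) b *\<^sub>R (0, c b))"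
      using v[of "fst w"] by (simp add: prod_eq_iff fst_sum snd_sum)
    also have "\<dots> \<in> span ?S"
      by (intro span_add span_sum span_scale span_base) auto
    finally show ?thesis .
  qed
  then have "span ?S = UNIV"
    by auto
  then show ?thesis
    using fin by (intro exI[of _ ?S]) auto
qed

locale courant_algebra = lie_algebra br
  for br :: "'a::real_vector \<Rightarrow> 'a \<Rightarrow> 'a" +
  fixes H :: "'a \<Rightarrow> 'a \<Rightarrow> 'a \<Rightarrow> real"
  assumes closed: "closed_three_form br H"
begin

lemma three_form_H: "three_form H"
  using closed by (simp add: closed_three_form_def)

lemma linear_H: "linear (\<lambda>X. H X Y Z)" "linear (\<lambda>Y. H X Y Z)" "linear (\<lambda>Z. H X Y Z)"
  using three_form_H by (simp_all add: three_form_def)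

lemma H_swap: "H Y X Z = - H X Y Z" "H X Z Y = - H X Y Z"
proof -
  have "H (X + Y) (X + Y) Z = 0" "H X (Y + Z) (Y + Z) = 0" "H X X Z = 0" "H Y Y Z = 0"
    "H X Y Y = 0" "H X Z Z = 0"
    using three_form_H by (simp_all add: three_form_def)
  then show "H Y X Z = - H X Y Z" "H X Z Y = - H X Y Z"
    by (simp_all add: linear_add[OF linear_H(1)] linear_add[OF linear_H(2)] linear_add[OF linear_H(3)])
qed

lemma fst_courant: "fst (courant br H u v) = br (fst u) (fst v)"
  by (simp add: courant_def)

lemma snd_courant: "dual_app (snd (courant br H u v)) Z =
    - dual_app (snd v) (br (fst u) Z) + dual_app (snd u) (br (fst v) Z) + H (fst u) (fst v) Z"
  by (simp add: courant_def dual_app_simps dual_app_lie_deriv dual_app_contract2[OF three_form_H])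

lemmas br_linear = linear_add[OF linear_br_left] linear_add[OF linear_br_right]
  linear_scale[OF linear_br_left] linear_scale[OF linear_br_right]

lemma bilinear_courant: "bilinear (courant br H)"
  unfolding bilinear_def
  by (auto intro!: linearI prod_eqI dual_eqI
      simp: fst_courant snd_courant br_linear dual_app_simps dual_app_linear algebra_simps
      linear_add[OF linear_H(1)] linear_add[OF linear_H(2)]
      linear_scale[OF linear_H(1)] linear_scale[OF linear_H(2)])

lemma courant_self: "courant br H u u = 0"
  using three_form_H
  by (auto intro!: prod_eqI dual_eqI
      simp: fst_courant snd_courant br_self dual_app_simps three_form_def)

lemma courant_jacobi:
  "courant br H u (courant br H v w) + courant br H v (courant br H w u)
    + courant br H w (courant br H u v) = 0"
proof (intro prod_eqI dual_eqI)
  show "fst (courant br H u (courant br H v w) + courant br H v (courant br H w u)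
    + courant br H w (courant br H u v)) = fst (0 :: 'a gen)"
    by (simp add: fst_courant jacobi)
next
  fix W
  obtain X \<xi> Y \<eta> Z \<zeta> where uvw: "u = (X, \<xi>)" "v = (Y, \<eta>)" "w = (Z, \<zeta>)"
    by (cases u, cases v, cases w)
  have "ce_diff3 br H X Y Z W = 0"
    using closed by (simp add: closed_three_form_def)
  moreover have "H (br X Y) Z W = - H Z (br X Y) W" "H (br Y Z) X W = - H X (br Y Z) W"
    "H (br X Z) Y W = H Y (br Z X) W"
    by (simp_all add: H_swap(1)[of _ "br _ _"] br_skew[of X Z] linear_neg[OF linear_H(1)])
  moreover have "H (br A W) P Q = H P Q (br A W)" for A P Q
    using H_swap(1)[of "br A W" P Q] H_swap(2)[of P "br A W" Q] by simp
  moreover have "H X Z (br Y W) = - H Z X (br Y W)"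
    by (rule H_swap)
  ultimately have *: "H X (br Y Z) W + H Y (br Z X) W + H Z (br X Y) W
      = H Y Z (br X W) + H Z X (br Y W) + H X Y (br Z W)"
    by (simp add: ce_diff3_def)
  show "dual_app (snd (courant br H u (courant br H v w) + courant br H v (courant br H w u)
    + courant br H w (courant br H u v))) W = dual_app (snd (0 :: 'a gen)) W"
    using * by (simp add: uvw fst_courant snd_courant dual_app_simps br_br dual_app_linear)
qed

sublocale gen: lie_algebra "courant br H"
  by standard (rule bilinear_courant courant_self courant_jacobi)+

lemma pairing_courant: "pairing (courant br H u v) w = pairing u (courant br H v w)"
proof -
  have "H (fst u) (fst v) (fst w) = H (fst v) (fst w) (fst u)"
    using H_swap(1)[of "fst v" "fst u"] H_swap(2)[of "fst v" "fst w" "fst u"] by simp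
  then show ?thesis
    by (simp add: pairing_def fst_courant snd_courant dual_app_linear
        br_skew[of "fst v" "fst u"] br_skew[of "fst w" "fst u"])
qed

text \<open>If \<open>\<gg>\<close> has nilpotency length \<open>m\<close>, then after \<open>m\<close> steps of the lower central
  series of \<open>\<gg> \<oplus> \<gg>\<^sup>*\<close> the vector part is gone, and with it every contribution of \<open>H\<close>.
  From there the bracket is the coadjoint action, and each further step enlarges the
  annihilator of the remaining 1-forms by one term of the lower central series of \<open>\<gg>\<close>,
  climbing up to \<open>\<gg>\<close> itself.\<close>

lemma nilpotent_courant:
  assumes "nilpotent_lie br"
  shows "nilpotent_lie (courant br H)"
proof -
  obtain m where m: "lower_central br m = {0}"
    using assms by (auto simp: nilpotent_lie_def)
  have fst: "lower_central (courant br H) k \<subseteq> {w. fst w \<in> lower_central br k}" for k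
  proof (induction k)
    case (Suc k)
    have "subspace {w :: 'a gen. fst w \<in> lower_central br (Suc k)}"
      using subspace_lower_central[of "Suc k"] by (auto simp: subspace_def simp del: lower_central.simps)
    then show ?case
      using Suc br_lower_central
      by (subst lower_central.simps, intro span_minimal)
        (auto simp: fst_courant simp del: lower_central.simps)
  qed simp
  have "lower_central (courant br H) (m + j)
      \<subseteq> {w. fst w = 0 \<and> (\<forall>Z\<in>lower_central br (m - j). dual_app (snd w) Z = 0)}" if "j \<le> m" for j
    using that
  proof (induction j)
    case 0
    then show ?case
      using fst[of m] by (auto simp: m dual_app_linear)
  next
    case (Suc j)
    have "br X Z \<in> lower_central br (m - j)" if "Z \<in> lower_central br (m - Suc j)" for X Z
      using br_lower_central[OF that, of X] Suc.prems by (simp only: Suc_diff_Suc Suc_le_eq)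
    moreover have "H X 0 Z = 0" "br X 0 = 0" "br 0 Z = 0" for X Z
      by (rule linear_0 linear_H linear_br_left linear_br_right)+
    ultimately have "{courant br H u v |u v. v \<in> lower_central (courant br H) (m + j)}
      \<subseteq> {w. fst w = 0 \<and> (\<forall>Z\<in>lower_central br (m - Suc j). dual_app (snd w) Z = 0)}"
      using Suc by (auto simp: fst_courant snd_courant dual_app_linear simp del: lower_central.simps)
    moreover have "subspace {w :: 'a gen. fst w = 0 \<and> (\<forall>Z\<in>lower_central br (m - Suc j). dual_app (snd w) Z = 0)}"
      by (auto simp: subspace_def dual_app_simps)
    ultimately show ?case
      by (simp add: span_minimal)
  qed
  from this[of m] have zero: "fst w = 0 \<and> (\<forall>Z. dual_app (snd w) Z = 0)"
    if "w \<in> lower_central (courant br H) (m + m)" for w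
    using that by auto
  have "lower_central (courant br H) (m + m) \<subseteq> {0}"
  proof
    fix w assume "w \<in> lower_central (courant br H) (m + m)"
    from zero[OF this] show "w \<in> {0}"
      by (auto simp: prod_eq_iff dual_app_simps intro!: dual_eqI)
  qed
  moreover have "0 \<in> lower_central (courant br H) (m + m)"
    by (rule subspace_0[OF gen.subspace_lower_central])
  ultimately show ?thesis
    unfolding nilpotent_lie_def by blast
qed

text \<open>The identity is integrability applied to the eigenvectors \<open>u - \<i> J u\<close> and
  \<open>v - \<i> J v\<close>.\<close>

lemma generalized_complex_integrable:
  assumes J: "generalized_complex br H J"
  shows "J (courant br H u v - courant br H (J u) (J v))
    = courant br H (J u) v + courant br H u (J v)"
proof -
  have lin: "linear J" and JJ: "\<And>v. J (J v) = - v"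
    using J by (auto simp: generalized_complex_def)
  have "(x, - J x) \<in> eigenspace_cx J \<i>" for x
    by (simp add: eigenspace_cx_def linear_cx_def scale_cx_def linear_neg[OF lin] JJ)
  then have "bilinear_cx (courant br H) (u, - J u) (v, - J v) \<in> eigenspace_cx J \<i>"
    using J by (simp add: generalized_complex_def)
  then show ?thesis
    by (simp add: eigenspace_cx_def linear_cx_def scale_cx_def bilinear_cx_def
        linear_neg[OF gen.linear_br_left] linear_neg[OF gen.linear_br_right])
qed

lemma abelian_of_generalized_kaehler:
  assumes fin: "finite_dimensional TYPE('a)" and nil: "nilpotent_lie br"
    and K: "generalized_kaehler br H J1 J2"
  shows "abelian_lie br"
proof -
  have J: "generalized_complex br H J1" "generalized_complex br H J2"
    using K unfolding generalized_kaehler_def by blast+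
  interpret nilpotent_kaehler_pair "courant br H" pairing J1 J2
  proof (intro nilpotent_kaehler_pair.intro nilpotent_kaehler_pair_axioms.intro)
    (* linear is itself a locale predicate, so unfold_locales would split the hypotheses on J1, J2 *)
    show "lie_algebra (courant br H)"
      by (rule gen.lie_algebra_axioms)
    show "linear J1" "linear J2"
      using J unfolding generalized_complex_def by blast+
    show "J1 (J1 v) = - v" "J2 (J2 v) = - v" for v
      using J unfolding generalized_complex_def by blast+
    show "pairing (J1 u) (J1 v) = pairing u v" "pairing (J2 u) (J2 v) = pairing u v" for u v
      using J unfolding generalized_complex_def by blast+
    show "J1 (J2 v) = J2 (J1 v)" for v
      using K unfolding generalized_kaehler_def by blast
    show "pairing (J1 (J2 v)) v > 0" if "v \<noteq> 0" for v
      using K that unfolding generalized_kaehler_def by blast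
  qed (rule finite_dimensional_gen[OF fin] nilpotent_courant[OF nil] bilinear_pairing pairing_sym
      pairing_courant generalized_complex_integrable[OF J(1)] generalized_complex_integrable[OF J(2)])+
  have "br X Y = fst (courant br H (X, 0) (Y, 0))" for X Y
    by (simp add: fst_courant)
  then show ?thesis
    using abelian by (simp add: abelian_lie_def)
qed

end

theorem theorem4p1:
  fixes br :: "'a::real_vector \<Rightarrow> 'a \<Rightarrow> 'a"
  assumes "lie_algebra br"
    and "finite_dimensional TYPE('a)"
    and "nilpotent_lie br"
    and "\<exists>H J1 J2. closed_three_form br H \<and> generalized_kaehler br H J1 J2"
  shows "abelian_lie br"
proof -
  obtain H J1 J2 where "closed_three_form br H" and K: "generalized_kaehler br H J1 J2"
    using assms(4) by blast
  then interpret courant_algebra br H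
    using assms(1) by (simp add: courant_algebra_def courant_algebra_axioms_def)
  show ?thesis
    using assms(2,3) K by (rule abelian_of_generalized_kaehler)
qed

end
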